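(* Let $q$ be a prime power, $n\ge 1$, $N=q^n-1$, $\alpha$ a primitive element of $\mathbb{F}_{q^n}$, and let $i_1,\dots,i_s\ge 1$ be integers lying in pairwise distinct $q$-cyclotomic cosets mod $N$, each of these cosets having size exactly $n$. Let $C$ be the cyclic code $$C=\left\{\left(\mathrm{Tr}_{\mathbb{F}_{q^n}/\mathbb{F}_q}\left(\lambda_1\alpha^{ki_1}+\cdots+\lambda_s\alpha^{ki_s}\right)\right)_{0\le k\le N-1} : \lambda_1,\dots,\lambda_s\in\mathbb{F}_{q^n}\right\}\subseteq \mathbb{F}_q^N.$$ (i) For $\mathbb{F}_q$-subspaces $V_1,\dots,V_s$ of $\mathbb{F}_{q^n}$ consider the $\mathbb{F}_q$-linear subcode $$C'=\left\{\left(\mathrm{Tr}_{\mathbb{F}_{q^n}/\mathbb{F}_q}\left(\beta_1\alpha^{ki_1}+\cdots+\beta_s\alpha^{ki_s}\right)\right)_{0\le k\le N-1} : \beta_j\in V_j,\ 1\le j\le s\right\}$$ of $C$. For $1\le j\le s$ let $\mathbb{F}_{q^{d_j}}$ be the largest intermediate field of $\mathbb{F}_{q^n}/\mathbb{F}_q$ such that $V_j$ is an $\mathbb{F}_{q^{d_j}}$-subspace of $\mathbb{F}_{q^n}$. Put $L_j=\frac{q^n-1}{q^{d_j}-1}$, $\ell_j=\frac{\mathrm{lcm}(i_j,L_j)}{i_j}$ for all $j$, and $\ell=\mathrm{lcm}(\ell_1,\dots,\ell_s)$. If $\ell\ne q^n-1=N$, then $C'$ is a quasi-cyclic subcode of $C$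 of index $\ell$. (ii) Let $\mathbb{F}_{q^{d_1}},\dots,\mathbb{F}_{q^{d_u}}$ be the intermediate fields of $\mathbb{F}_{q^n}/\mathbb{F}_q$, where $d_1=1$ and $d_u=n$. Put $L_a=\frac{q^n-1}{q^{d_a}-1}$ for $1\le a\le u$ and $\ell_t^a=\frac{\mathrm{lcm}(i_t,L_a)}{i_t}$ for $1\le t\le s$, $1\le a\le u$. Let $$I=\left\{\mathrm{lcm}\left(\ell_{t_1}^{a_1},\dots,\ell_{t_m}^{a_m}\right) : 1\le m\le s,\ 1\le a_1,\dots,a_m\le u,\ 1\le t_1,\dots,t_m\le s,\ t_i\ne t_j \text{ for any } i\neq j\right\}\setminus\{q^n-1\}.$$ Then $C$ has quasi-cyclic subcodes of index $\ell$ for every $\ell\in I$, and $C$ has no quasi-cyclic subcode of different index.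
   Context: The $q$-cyclotomic coset of $i$ mod $N$ is $\{i q^r \bmod N : r\ge 0\}$. A linear code $D\subseteq\mathbb{F}_q^N$ is quasi-cyclic (QC) of index $\ell$ if it is invariant under cyclic shift of codewords by $\ell$ positions and $\ell$ is the smallest positive integer with this property; index $1$ means cyclic. Codes whose minimal such $\ell$ equals the full length $N$ are not regarded as quasi-cyclic here. If $V_j=\{0\}$, the largest field over which it is a vector space is $\mathbb{F}_{q^n}$.
   Formalization: In (ii), "no quasi-cyclic subcode of different index" is claimed only for subcodes of the form C' in (i); for all linear subcodes it fails: q=2, n=4, (i_1,i_2)=(2,7) gives I={1,5}, but the words Tr(g(α^{2k}+α^{7k})) form a subcode of index 3. *)

theory Defs
  imports "HOL-Number_Theory.Number_Theory" "HOL-Library.FuncSet" "HOL-Library.Cardinality"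
begin

text \<open>
  The big field of order \<open>q ^ n\<close> is a type of class \<open>finite_field\<close>; the base field of order \<open>q\<close>
  and the intermediate fields are subsets of that type.
\<close>

definition is_subfield :: "'a::field set \<Rightarrow> bool" where
  "is_subfield K \<longleftrightarrow> 0 \<in> K \<and> 1 \<in> K \<and> (\<forall>x\<in>K. \<forall>y\<in>K. x + y \<in> K \<and> x * y \<in> K)
     \<and> (\<forall>x\<in>K. - x \<in> K \<and> inverse x \<in> K)"

definition intermediate_field :: "'a::field set \<Rightarrow> 'a set \<Rightarrow> bool" where
  "intermediate_field F K \<longleftrightarrow> is_subfield K \<and> F \<subseteq> K"

definition subspace_over :: "'a::field set \<Rightarrow> 'a set \<Rightarrow> bool" where
  "subspace_over K V \<longleftrightarrow> 0 \<in> V \<and> (\<forall>x\<in>V. \<forall>y\<in>V. x + y \<in> V) \<and> (\<forall>c\<in>K. \<forall>x\<in>V. c * x \<in> V)"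

definition largest_scalar_field :: "'a::field set \<Rightarrow> 'a set \<Rightarrow> 'a set \<Rightarrow> bool" where
  "largest_scalar_field F V K \<longleftrightarrow> intermediate_field F K \<and> subspace_over K V
     \<and> (\<forall>K'. intermediate_field F K' \<and> subspace_over K' V \<longrightarrow> K' \<subseteq> K)"

definition primitive_element :: "'a::finite_field \<Rightarrow> bool" where
  "primitive_element \<alpha> \<longleftrightarrow> range (\<lambda>k::nat. \<alpha> ^ k) = UNIV - {0}"

text \<open>The trace from the field of order \<open>q ^ n\<close> to its subfield of order \<open>q\<close>.\<close>

definition field_trace :: "nat \<Rightarrow> nat \<Rightarrow> 'a::field \<Rightarrow> 'a" where
  "field_trace q n x = (\<Sum>r<n. x ^ (q ^ r))"

definition cyclotomic_coset :: "nat \<Rightarrow> nat \<Rightarrow> nat \<Rightarrow> nat set" where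
  "cyclotomic_coset q N i = range (\<lambda>r. (i * q ^ r) mod N)"

definition linear_code :: "'a::field set \<Rightarrow> nat \<Rightarrow> 'a list set \<Rightarrow> bool" where
  "linear_code F N D \<longleftrightarrow> D \<subseteq> {w. length w = N \<and> set w \<subseteq> F} \<and> replicate N 0 \<in> D
     \<and> (\<forall>v\<in>D. \<forall>w\<in>D. map2 (+) v w \<in> D) \<and> (\<forall>c\<in>F. \<forall>w\<in>D. map ((*) c) w \<in> D)"

text \<open>
  Codes are finite, so invariance under the left shift \<open>rotate m\<close> is the same as invariance under
  the right shift by \<open>m\<close> positions.
\<close>

definition shift_invariant :: "nat \<Rightarrow> 'a list set \<Rightarrow> bool" where
  "shift_invariant m D \<longleftrightarrow> (\<forall>w\<in>D. rotate m w \<in> D)"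

text \<open>
  Every code of length \<open>N\<close> is invariant under the shift by \<open>N\<close>; codes for which \<open>N\<close> is already the
  smallest such shift do not count as quasi-cyclic.
\<close>

definition quasi_cyclic :: "'a::field set \<Rightarrow> nat \<Rightarrow> nat \<Rightarrow> 'a list set \<Rightarrow> bool" where
  "quasi_cyclic F N l D \<longleftrightarrow> linear_code F N D \<and> l \<noteq> N \<and> 0 < l \<and> shift_invariant l D
     \<and> (\<forall>m. 0 < m \<and> m < l \<longrightarrow> \<not> shift_invariant m D)"

text \<open>
  Coefficients \<open>\<beta> j\<close> range over \<open>V j\<close> for \<open>1 \<le> j \<le> s\<close>; the full cyclic code is the case where
  every \<open>V j\<close> is the whole field.
\<close>

definition trace_code ::
  "nat \<Rightarrow> nat \<Rightarrow> 'a::field \<Rightarrow> nat \<Rightarrow> (nat \<Rightarrow> nat) \<Rightarrow> (nat \<Rightarrow> 'a set) \<Rightarrow> 'a list set" where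
  "trace_code q n \<alpha> s i V =
     {map (\<lambda>k. field_trace q n (\<Sum>j=1..s. \<beta> j * \<alpha> ^ (k * i j))) [0..<q ^ n - 1] | \<beta>.
        \<forall>j\<in>{1..s}. \<beta> j \<in> V j}"

abbreviation full_trace_code ::
  "nat \<Rightarrow> nat \<Rightarrow> 'a::field \<Rightarrow> nat \<Rightarrow> (nat \<Rightarrow> nat) \<Rightarrow> 'a list set" where
  "full_trace_code q n \<alpha> s i \<equiv> trace_code q n \<alpha> s i (\<lambda>_. UNIV)"

text \<open>
  The subcodes obtained by restricting each coefficient separately to an \<open>F\<close>-subspace. A general
  linear subcode of the full code need not have this form as soon as \<open>s \<ge> 2\<close>, and its index need
  not be among those of the subcodes of this form: for \<open>q = 2\<close>, \<open>n = 4\<close> and exponents \<open>2, 7\<close>,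
  the subcode of all words with entries \<open>Tr (\<gamma> * (\<alpha> ^ (2 * k) + \<alpha> ^ (7 * k)))\<close> has index \<open>3\<close>,
  while subcodes of this form only have index \<open>1\<close> or \<open>5\<close>.
\<close>

definition coefficient_subcode ::
  "'a::field set \<Rightarrow> nat \<Rightarrow> nat \<Rightarrow> 'a \<Rightarrow> nat \<Rightarrow> (nat \<Rightarrow> nat) \<Rightarrow> 'a list set \<Rightarrow> bool" where
  "coefficient_subcode F q n \<alpha> s i D \<longleftrightarrow>
     (\<exists>V. (\<forall>j\<in>{1..s}. subspace_over F (V j)) \<and> D = trace_code q n \<alpha> s i V)"

definition L_quot :: "nat \<Rightarrow> nat \<Rightarrow> nat \<Rightarrow> nat" where
  "L_quot q n d = (q ^ n - 1) div (q ^ d - 1)"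

definition ell :: "nat \<Rightarrow> nat \<Rightarrow> nat \<Rightarrow> nat \<Rightarrow> nat" where
  "ell q n e d = lcm e (L_quot q n d) div e"

text \<open>\<open>d 1, \<dots>, d u\<close> are the degrees over the base field of all the intermediate fields.\<close>

definition index_set ::
  "nat \<Rightarrow> nat \<Rightarrow> nat \<Rightarrow> (nat \<Rightarrow> nat) \<Rightarrow> nat \<Rightarrow> (nat \<Rightarrow> nat) \<Rightarrow> nat set" where
  "index_set q n s i u d =
     {Lcm ((\<lambda>r. ell q n (i (t r)) (d (a r))) ` {1..m}) | m a t.
        1 \<le> m \<and> m \<le> s \<and> a \<in> {1..m} \<rightarrow> {1..u} \<and> t \<in> {1..m} \<rightarrow> {1..s} \<and> inj_on t {1..m}}
     - {q ^ n - 1}"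

end

theory Submission
  imports Defs "HOL-Computational_Algebra.Polynomial"
begin

text \<open>
  Shifting a word by \<open>m\<close> positions multiplies its \<open>j\<close>-th coefficient by \<open>\<alpha> ^ (m * i j)\<close>, and a word
  determines its coefficients. Hence the code is invariant under this shift iff multiplication by
  \<open>\<alpha> ^ (m * i j)\<close> maps each \<open>V j\<close> into itself, that is, iff \<open>\<alpha> ^ (m * i j)\<close> lies in the largest
  scalar field of \<open>V j\<close>. The powers of \<open>\<alpha>\<close> in the field of order \<open>q ^ d\<close> are those with exponent
  divisible by \<open>L = (q ^ n - 1) div (q ^ d - 1)\<close>, and \<open>L dvd m * i j\<close> iff \<open>lcm (i j) L div i j\<close>
  divides \<open>m\<close>. So the invariant shifts are exactly the multiples of the least common multiple of
  these numbers.
\<close>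

section \<open>Powers of a primitive element\<close>

lemma finite_field_power_card_minus_1:
  fixes x :: "'a::finite_field"
  assumes "x \<noteq> 0"
  shows "x ^ (CARD('a) - 1) = 1"
proof -
  have "x * x ^ (CARD('a) - 1) = x"
    using finite_field_power_card_eq_same[of x]
    by (metis power_minus_mult finite_UNIV_card_ge_0 finite mult.commute)
  with assms show ?thesis by simp
qed

lemma finite_field_CARD_gt_1: "CARD('a::finite_field) > 1"
proof -
  have "card {0, 1 :: 'a} \<le> CARD('a)" by (intro card_mono) auto
  thus ?thesis by simp
qed

lemma primitive_element_nonzero: "primitive_element \<alpha> \<Longrightarrow> \<alpha> \<noteq> 0"
  unfolding primitive_element_def using rangeI[of "\<lambda>k. \<alpha> ^ k" 1] by auto

lemma power_mod_CARD_minus_1: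
  fixes x :: "'a::finite_field"
  assumes "x \<noteq> 0"
  shows "x ^ (k mod (CARD('a) - 1)) = x ^ k"
proof -
  have "x ^ k = x ^ ((CARD('a) - 1) * (k div (CARD('a) - 1)) + k mod (CARD('a) - 1))"
    by simp
  also have "\<dots> = x ^ (k mod (CARD('a) - 1))"
    by (simp only: power_add power_mult finite_field_power_card_minus_1[OF assms]) simp
  finally show ?thesis by simp
qed

text \<open>Reducing exponents modulo \<open>CARD('a) - 1\<close> keeps the map surjective.
  Injectivity then follows by counting, since both sets have \<open>CARD('a) - 1\<close>
  elements.\<close>

lemma bij_betw_primitive_powers:
  fixes \<alpha> :: "'a::finite_field"
  assumes "primitive_element \<alpha>"
  shows "bij_betw (\<lambda>k. \<alpha> ^ k) {..<CARD('a) - 1} (UNIV - {0})"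
proof -
  let ?N = "CARD('a) - 1"
  have "x \<in> (\<lambda>k. \<alpha> ^ k) ` {..<?N}" if "x \<noteq> 0" for x
  proof -
    from that assms have "x \<in> range (\<lambda>k. \<alpha> ^ k)" by (simp add: primitive_element_def)
    then obtain k where "x = \<alpha> ^ k" by auto
    hence "x = \<alpha> ^ (k mod ?N)"
      using power_mod_CARD_minus_1[OF primitive_element_nonzero[OF assms]] by simp
    moreover have "k mod ?N < ?N" using finite_field_CARD_gt_1[where 'a='a] by simp
    ultimately show ?thesis by blast
  qed
  hence img: "(\<lambda>k. \<alpha> ^ k) ` {..<?N} = UNIV - {0}"
    using primitive_element_nonzero[OF assms] by auto
  moreover have "inj_on (\<lambda>k. \<alpha> ^ k) {..<?N}"
    by (rule eq_card_imp_inj_on) (simp, simp only: img, simp add: card_Diff_singleton)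
  ultimately show ?thesis by (simp add: bij_betw_def)
qed

lemma primitive_power_eq_iff:
  fixes \<alpha> :: "'a::finite_field"
  assumes "primitive_element \<alpha>"
  shows "\<alpha> ^ a = \<alpha> ^ b \<longleftrightarrow> [a = b] (mod (CARD('a) - 1))"
proof -
  let ?N = "CARD('a) - 1"
  note nz = primitive_element_nonzero[OF assms]
  have "a mod ?N < ?N" "b mod ?N < ?N" using finite_field_CARD_gt_1[where 'a='a] by simp_all
  hence "\<alpha> ^ (a mod ?N) = \<alpha> ^ (b mod ?N) \<longleftrightarrow> a mod ?N = b mod ?N"
    using bij_betw_primitive_powers[OF assms] by (auto simp: bij_betw_def inj_on_def)
  thus ?thesis by (simp only: power_mod_CARD_minus_1[OF nz] cong_def)
qed

lemma primitive_power_eq_1_iff: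
  fixes \<alpha> :: "'a::finite_field"
  assumes "primitive_element \<alpha>"
  shows "\<alpha> ^ a = 1 \<longleftrightarrow> CARD('a) - 1 dvd a"
  using primitive_power_eq_iff[OF assms, of a 0] by (simp add: cong_0_iff)

lemma nonzero_eq_primitive_power:
  fixes \<alpha> :: "'a::finite_field"
  assumes "primitive_element \<alpha>" "x \<noteq> 0"
  obtains k where "x = \<alpha> ^ k"
  using assms unfolding primitive_element_def by blast

section \<open>Subfields described by exponents\<close>

lemma subfield_power_mem: "is_subfield K \<Longrightarrow> x \<in> K \<Longrightarrow> x ^ k \<in> K"
  by (induction k) (auto simp: is_subfield_def)

text \<open>The exponents \<open>k\<close> with \<open>\<alpha> ^ k \<in> K\<close> are the multiples of the least positive one, \<open>g\<close>;
  counting the \<open>N div g\<close> nonzero elements of \<open>K\<close> identifies \<open>g\<close>.\<close>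

lemma subfield_primitive_powers:
  fixes \<alpha> :: "'a::finite_field"
  assumes prim: "primitive_element \<alpha>" and K: "is_subfield K"
  shows "card K - 1 dvd CARD('a) - 1"
    and "\<alpha> ^ k \<in> K \<longleftrightarrow> (CARD('a) - 1) div (card K - 1) dvd k"
proof -
  let ?N = "CARD('a) - 1"
  note nz = primitive_element_nonzero[OF prim]
  have N0: "?N > 0" using finite_field_CARD_gt_1[where 'a='a] by simp
  have one: "\<alpha> ^ ?N = 1" by (rule finite_field_power_card_minus_1[OF nz])
  define g where "g = (LEAST k. 0 < k \<and> \<alpha> ^ k \<in> K)"
  have ex: "0 < ?N \<and> \<alpha> ^ ?N \<in> K" using N0 one K by (simp add: is_subfield_def)
  have g: "0 < g" "\<alpha> ^ g \<in> K"
    using LeastI[where P = "\<lambda>k. 0 < k \<and> \<alpha> ^ k \<in> K", OF ex] unfolding g_def by auto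
  have mem: "\<alpha> ^ k \<in> K \<longleftrightarrow> g dvd k" for k
  proof
    assume "g dvd k"
    thus "\<alpha> ^ k \<in> K"
      using subfield_power_mem[OF K g(2)] by (auto simp: power_mult elim!: dvdE)
  next
    assume k: "\<alpha> ^ k \<in> K"
    \<comment> \<open>Division with remainder: dividing by a power of \<open>\<alpha> ^ g\<close>
      leaves \<open>\<alpha> ^ (k mod g)\<close> in \<open>K\<close>, and minimality of
      \<open>g\<close> forces the remainder to vanish.\<close>
    have "\<alpha> ^ k = (\<alpha> ^ g) ^ (k div g) * \<alpha> ^ (k mod g)"
      by (simp flip: power_mult power_add)
    hence "\<alpha> ^ (k mod g) = inverse ((\<alpha> ^ g) ^ (k div g)) * \<alpha> ^ k"
      using nz by simp
    also have "\<dots> \<in> K"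
      using K k subfield_power_mem[OF K g(2)] unfolding is_subfield_def by blast
    finally have "\<alpha> ^ (k mod g) \<in> K" .
    moreover have "k mod g < g" using g(1) by simp
    ultimately have "k mod g = 0"
      using not_less_Least[of "k mod g" "\<lambda>k. 0 < k \<and> \<alpha> ^ k \<in> K"] unfolding g_def by auto
    thus "g dvd k" by auto
  qed
  have "g dvd ?N" using mem[of ?N] one K by (simp add: is_subfield_def)
  then obtain h where h: "?N = g * h" by (auto elim: dvdE)
  have h0: "h > 0" using h N0 by (auto intro: gr0I)
  have "K - {0} = (\<lambda>k. \<alpha> ^ k) ` ((\<lambda>j. g * j) ` {..<h})"
  proof (intro equalityI subsetI)
    fix x assume x: "x \<in> K - {0}"
    then obtain k where k: "k < ?N" "x = \<alpha> ^ k"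
      using bij_betw_imp_surj_on[OF bij_betw_primitive_powers[OF prim]] by blast
    with x mem obtain j where j: "k = g * j" by (auto elim: dvdE)
    with k h g(1) have "j < h" by simp
    with j k show "x \<in> (\<lambda>k. \<alpha> ^ k) ` ((\<lambda>j. g * j) ` {..<h})" by blast
  next
    fix x assume "x \<in> (\<lambda>k. \<alpha> ^ k) ` ((\<lambda>j. g * j) ` {..<h})"
    then obtain j where "x = \<alpha> ^ (g * j)" by blast
    thus "x \<in> K - {0}" using mem[of "g * j"] nz by simp
  qed
  moreover have "card ((\<lambda>k. \<alpha> ^ k) ` ((\<lambda>j. g * j) ` {..<h})) = h"
  proof -
    \<comment> \<open>The exponents \<open>g * j\<close> with \<open>j < h\<close> stay below
      \<open>?N\<close>, where distinct exponents give distinct powers, so no element is counted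
      twice.\<close>
    have "(\<lambda>j. g * j) ` {..<h} \<subseteq> {..<?N}" using h g(1) by auto
    hence "inj_on (\<lambda>k. \<alpha> ^ k) ((\<lambda>j. g * j) ` {..<h})"
      using bij_betw_imp_inj_on[OF bij_betw_primitive_powers[OF prim]] inj_on_subset by blast
    hence "card ((\<lambda>k. \<alpha> ^ k) ` ((\<lambda>j. g * j) ` {..<h})) = card ((\<lambda>j. g * j) ` {..<h})"
      by (rule card_image)
    also have "\<dots> = h" using g(1) by (subst card_image) (auto simp: inj_on_def)
    finally show ?thesis .
  qed
  ultimately have "card (K - {0}) = h" by simp
  hence c: "card K - 1 = h" using K by (simp add: is_subfield_def card_Diff_singleton)
  show "card K - 1 dvd CARD('a) - 1" unfolding c h by simp
  show "\<alpha> ^ k \<in> K \<longleftrightarrow> (CARD('a) - 1) div (card K - 1) dvd k"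
    unfolding c h using h0 mem by simp
qed

lemma subfield_card_gt_1:
  assumes "is_subfield (K :: 'a::finite_field set)"
  shows "card K > 1"
proof -
  have "card {0, 1 :: 'a} \<le> card K"
    using assms by (intro card_mono) (auto simp: is_subfield_def)
  thus ?thesis by simp
qed

text \<open>For \<open>x = \<alpha> ^ k\<close> and \<open>CARD('a) - 1 = (card K - 1) * h\<close>,
  both sides say that \<open>h\<close> divides \<open>k\<close>. Applied to the base field, this
  turns membership into the equation \<open>x ^ q = x\<close>, which is easy to check for traces and
  scalars.\<close>

lemma subfield_mem_iff_power_card:
  fixes \<alpha> :: "'a::finite_field" and K :: "'a set"
  assumes prim: "primitive_element \<alpha>" and K: "is_subfield K"
  shows "x \<in> K \<longleftrightarrow> x ^ card K = x"
proof (cases "x = 0")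
  case True
  thus ?thesis using K subfield_card_gt_1[OF K] by (auto simp: is_subfield_def)
next
  case False
  then obtain k where k: "x = \<alpha> ^ k" using nonzero_eq_primitive_power[OF prim] by blast
  let ?c = "card K - 1"
  obtain h where h: "CARD('a) - 1 = ?c * h"
    using subfield_primitive_powers(1)[OF prim K] by (auto elim: dvdE)
  have c0: "?c > 0" using subfield_card_gt_1[OF K] by simp
  have "x ^ card K = x \<longleftrightarrow> x ^ ?c * x = x"
    using c0 by (subst power_minus_mult) auto
  also have "\<dots> \<longleftrightarrow> x ^ ?c = 1" using False by simp
  also have "\<dots> \<longleftrightarrow> \<alpha> ^ (k * ?c) = 1" by (simp add: k power_mult)
  also have "\<dots> \<longleftrightarrow> h dvd k"
    unfolding primitive_power_eq_1_iff[OF prim] h using c0 by (simp add: mult.commute)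
  also have "\<dots> \<longleftrightarrow> x \<in> K"
    unfolding k subfield_primitive_powers(2)[OF prim K] h using c0 by simp
  finally show ?thesis by simp
qed

section \<open>Frobenius and the trace\<close>

text \<open>The characteristic divides the prime power \<open>CARD('a)\<close>, so it is the prime
  of which \<open>q\<close> is a power; raising to \<open>q ^ r\<close> is therefore an iterated
  Frobenius map.\<close>

lemma frobenius_sum:
  fixes f :: "'b \<Rightarrow> 'a::finite_field"
  assumes "primepow q" "CARD('a) = q ^ n"
  shows "(\<Sum>x\<in>A. f x) ^ (q ^ r) = (\<Sum>x\<in>A. f x ^ (q ^ r))"
proof -
  obtain p k where p: "prime p" "k > 0" "q = p ^ k"
    using assms(1) by (auto simp: primepow_def)
  have "prime CHAR('a)" by (rule prime_CHAR_semidom) (simp add: CHAR_pos)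
  moreover have "CHAR('a) dvd p ^ (k * n)"
    using CHAR_dvd_CARD[where 'a='a] assms(2) p(3) by (simp add: power_mult)
  ultimately have "CHAR('a) = p"
    using p(1) prime_dvd_power primes_dvd_imp_eq by blast
  hence "q ^ r = CHAR('a) ^ (k * r)" using p by (simp add: power_mult)
  thus ?thesis using freshmans_dream_sum'[OF \<open>prime CHAR('a)\<close>] by blast
qed

lemma field_trace_sum:
  fixes f :: "'b \<Rightarrow> 'a::finite_field"
  assumes "primepow q" "CARD('a) = q ^ n"
  shows "field_trace q m (\<Sum>x\<in>A. f x) = (\<Sum>x\<in>A. field_trace q m (f x))"
  unfolding field_trace_def frobenius_sum[OF assms] by (rule sum.swap)

lemma field_trace_add:
  fixes x y :: "'a::finite_field"
  assumes "primepow q" "CARD('a) = q ^ n"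
  shows "field_trace q m (x + y) = field_trace q m x + field_trace q m y"
  \<comment> \<open>A sum of two terms is a sum indexed by the two Booleans.\<close>
  using field_trace_sum[OF assms, of m "\<lambda>b. if b then x else y" "UNIV :: bool set"]
  by (simp add: UNIV_bool add.commute)

lemma field_trace_mult:
  fixes c :: "'a::finite_field"
  assumes "c ^ q = c"
  shows "field_trace q m (c * x) = c * field_trace q m x"
proof -
  have "c ^ (q ^ r) = c" for r
    by (induction r) (simp_all add: assms power_mult mult.commute[of q])
  thus ?thesis by (simp add: field_trace_def power_mult_distrib sum_distrib_left)
qed

text \<open>Raising to the power \<open>q\<close> permutes the conjugates of \<open>x\<close>
  cyclically: each moves on by one, and the last becomes \<open>x ^ (q ^ n) = x\<close>.\<close>

lemma field_trace_power_q:
  fixes x :: "'a::finite_field"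
  assumes "primepow q" "CARD('a) = q ^ n"
  shows "field_trace q n x ^ q = field_trace q n x"
proof -
  have "field_trace q n x ^ q = (\<Sum>r<n. x ^ (q ^ Suc r))"
    using frobenius_sum[OF assms, of "\<lambda>r. x ^ (q ^ r)" "{..<n}" 1]
    by (simp add: field_trace_def power_mult[symmetric] mult.commute)
  \<comment> \<open>The sum of the first \<open>n + 1\<close> conjugates is split off at its first
    and at its last term.\<close>
  moreover have "x + (\<Sum>r<n. x ^ (q ^ Suc r)) = (\<Sum>r<n. x ^ (q ^ r)) + x ^ (q ^ n)"
    using sum.lessThan_Suc_shift[of "\<lambda>r. x ^ (q ^ r)" n] by simp
  moreover have "x ^ (q ^ n) = x"
    using finite_field_power_card_eq_same[of x] assms(2) by simp
  ultimately show ?thesis by (simp add: field_trace_def)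
qed

lemma field_trace_in_subfield:
  fixes \<alpha> :: "'a::finite_field" and F :: "'a set"
  assumes "primepow q" "CARD('a) = q ^ n" "primitive_element \<alpha>" "is_subfield F" "card F = q"
  shows "field_trace q n x \<in> F"
  using subfield_mem_iff_power_card[OF assms(3,4)] field_trace_power_q[OF assms(1,2)] assms(5)
  by simp

section \<open>Cyclotomic cosets\<close>

lemma q_power_cong_1:
  assumes "q \<ge> (1::nat)"
  shows "[q ^ (n * b) = 1] (mod (q ^ n - 1))"
proof -
  have "[q ^ n = 1] (mod (q ^ n - 1))"
    using assms by (simp add: cong_altdef_nat)
  from cong_pow[OF this, of b] show ?thesis by (simp add: power_mult)
qed

text \<open>Since \<open>q ^ n\<close> is 1 modulo \<open>q ^ n - 1\<close>, only
  \<open>r mod n\<close> matters. A coset of size \<open>n\<close> thus has no repetition among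
  these \<open>n\<close> residues.\<close>

lemma cyclotomic_coset_eq_image:
  assumes "q \<ge> 1" "n \<ge> 1"
  shows "cyclotomic_coset q (q ^ n - 1) i = (\<lambda>r. (i * q ^ r) mod (q ^ n - 1)) ` {..<n}"
proof -
  have "(i * q ^ r) mod (q ^ n - 1) \<in> (\<lambda>r. (i * q ^ r) mod (q ^ n - 1)) ` {..<n}" for r
  proof -
    have "q ^ r = q ^ (n * (r div n)) * q ^ (r mod n)" by (simp flip: power_add)
    hence "[i * q ^ r = i * (1 * q ^ (r mod n))] (mod (q ^ n - 1))"
      using q_power_cong_1[OF assms(1), of n "r div n"] cong_mult cong_refl by metis
    thus ?thesis using assms(2) by (intro image_eqI[of _ _ "r mod n"]) (auto simp: cong_def)
  qed
  thus ?thesis by (auto simp: cyclotomic_coset_def)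
qed

text \<open>Powers of \<open>q\<close> are invertible modulo \<open>q ^ n - 1\<close>, so
  \<open>j\<close> is \<open>i\<close> times a power of \<open>q\<close>. By symmetry, cosets that
  meet coincide.\<close>

lemma cyclotomic_coset_subset:
  assumes "q \<ge> 1" "n \<ge> 1" and e: "[i * q ^ a = j * q ^ b] (mod (q ^ n - 1))"
  shows "cyclotomic_coset q (q ^ n - 1) j \<subseteq> cyclotomic_coset q (q ^ n - 1) i"
proof -
  have "j * q ^ r mod (q ^ n - 1) \<in> cyclotomic_coset q (q ^ n - 1) i" for r
  proof -
    obtain m where m: "n = Suc m" using assms(2) by (cases n) auto
    \<comment> \<open>With \<open>m = n - 1\<close>, the factor \<open>q ^ (n * b)\<close>,
      congruent to 1, splits into \<open>q ^ b\<close> and its inverse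
      \<open>q ^ (m * b)\<close>.\<close>
    have "[j * q ^ r = j * q ^ r * q ^ (n * b)] (mod (q ^ n - 1))"
      using cong_mult[OF cong_refl q_power_cong_1[OF assms(1), of n b], of "j * q ^ r"]
      by (simp add: cong_sym_eq)
    also have "j * q ^ r * q ^ (n * b) = j * q ^ b * q ^ (r + m * b)"
      by (simp add: m power_add algebra_simps)
    also have "[\<dots> = i * q ^ a * q ^ (r + m * b)] (mod (q ^ n - 1))"
      by (intro cong_mult cong_refl cong_sym[OF e])
    also have "i * q ^ a * q ^ (r + m * b) = i * q ^ (a + r + m * b)"
      by (simp add: power_add algebra_simps)
    finally show ?thesis unfolding cong_def cyclotomic_coset_def by (rule range_eqI)
  qed
  thus ?thesis by (auto simp: cyclotomic_coset_def)
qed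

text \<open>A collision between different \<open>j\<close> would make two cosets meet and hence
  coincide; a collision within one coset would make it smaller than \<open>n\<close>. This keeps
  apart the monomials of the polynomial attached to a word.\<close>

lemma cyclotomic_exponents_inj:
  assumes q: "q \<ge> 1" "n \<ge> 1" and N: "N = q ^ n - 1"
    and dist: "\<forall>j\<in>J. \<forall>k\<in>J. j \<noteq> k \<longrightarrow> cyclotomic_coset q N (i j) \<noteq> cyclotomic_coset q N (i k)"
    and size: "\<forall>j\<in>J. card (cyclotomic_coset q N (i j)) = n"
  shows "inj_on (\<lambda>(j, r). (i j * q ^ r) mod N) (J \<times> {..<n})"
proof (rule inj_onI)
  fix x y
  assume xy: "x \<in> J \<times> {..<n}" "y \<in> J \<times> {..<n}"
    and e: "(\<lambda>(j, r). (i j * q ^ r) mod N) x = (\<lambda>(j, r). (i j * q ^ r) mod N) y"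
  obtain j r k t where x: "x = (j, r)" and y: "y = (k, t)" by (cases x, cases y)
  have J: "j \<in> J" "k \<in> J" and rt: "r \<in> {..<n}" "t \<in> {..<n}"
    and eq: "i j * q ^ r mod N = i k * q ^ t mod N"
    using xy e unfolding x y by auto
  have "cyclotomic_coset q N (i j) = cyclotomic_coset q N (i k)"
    using cyclotomic_coset_subset[OF q, of "i j" r "i k" t]
      cyclotomic_coset_subset[OF q, of "i k" t "i j" r] eq
    unfolding cong_def N by auto
  with dist J have jk: "j = k" by blast
  have "inj_on (\<lambda>r. (i j * q ^ r) mod N) {..<n}"
    using size J unfolding N cyclotomic_coset_eq_image[OF q] by (intro eq_card_imp_inj_on) auto
  from inj_onD[OF this _ rt] eq jk show "x = y" by (simp add: x y)
qed

section \<open>Words and their coefficients\<close>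

text \<open>With the coefficients as an explicit argument, addition, scaling and rotation of words
  become operations on \<open>\<beta>\<close>.\<close>

definition trace_word ::
  "nat \<Rightarrow> nat \<Rightarrow> 'a::field \<Rightarrow> nat \<Rightarrow> (nat \<Rightarrow> nat) \<Rightarrow> (nat \<Rightarrow> 'a) \<Rightarrow> 'a list" where
  "trace_word q n \<alpha> s i \<beta> =
     map (\<lambda>k. field_trace q n (\<Sum>j=1..s. \<beta> j * \<alpha> ^ (k * i j))) [0..<q ^ n - 1]"

lemma trace_code_eq: "trace_code q n \<alpha> s i V = trace_word q n \<alpha> s i ` {\<beta>. \<forall>j\<in>{1..s}. \<beta> j \<in> V j}"
  by (auto simp: trace_code_def trace_word_def)

lemma length_trace_word [simp]: "length (trace_word q n \<alpha> s i \<beta>) = q ^ n - 1"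
  by (simp add: trace_word_def)

lemma nth_trace_word:
  "k < q ^ n - 1 \<Longrightarrow>
    trace_word q n \<alpha> s i \<beta> ! k = field_trace q n (\<Sum>j=1..s. \<beta> j * \<alpha> ^ (k * i j))"
  by (simp add: trace_word_def)

lemma trace_word_add:
  fixes \<alpha> :: "'a::finite_field"
  assumes "primepow q" "CARD('a) = q ^ n"
  shows "map2 (+) (trace_word q n \<alpha> s i \<beta>) (trace_word q n \<alpha> s i \<gamma>)
    = trace_word q n \<alpha> s i (\<lambda>j. \<beta> j + \<gamma> j)"
  by (rule nth_equalityI)
    (simp_all add: nth_trace_word field_trace_add[OF assms, symmetric] sum.distrib[symmetric]
      distrib_right)

lemma trace_word_mult:
  fixes \<alpha> :: "'a::finite_field"
  assumes "c ^ q = c"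
  shows "map ((*) c) (trace_word q n \<alpha> s i \<beta>) = trace_word q n \<alpha> s i (\<lambda>j. c * \<beta> j)"
  by (rule nth_equalityI)
    (simp_all add: nth_trace_word field_trace_mult[OF assms, symmetric] sum_distrib_left mult.assoc)

lemma field_trace_0:
  assumes "q \<ge> 1"
  shows "field_trace q n (0 :: 'a::field) = 0"
  using assms by (simp add: field_trace_def power_0_left)

text \<open>Position \<open>k\<close> of the rotated word is position \<open>m + k\<close> of the
  original; the wraparound is harmless because \<open>\<alpha> ^ (q ^ n - 1) = 1\<close>.\<close>

lemma rotate_trace_word:
  fixes \<alpha> :: "'a::finite_field"
  assumes "primitive_element \<alpha>" "CARD('a) = q ^ n"
  shows "rotate m (trace_word q n \<alpha> s i \<beta>)
    = trace_word q n \<alpha> s i (\<lambda>j. \<alpha> ^ (m * i j) * \<beta> j)"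
proof (rule nth_equalityI)
  fix k assume "k < length (rotate m (trace_word q n \<alpha> s i \<beta>))"
  hence k: "k < q ^ n - 1" by simp
  hence "(m + k) mod (q ^ n - 1) < q ^ n - 1" by simp
  moreover have "\<alpha> ^ ((m + k) mod (q ^ n - 1) * i j) = \<alpha> ^ (m * i j) * \<alpha> ^ (k * i j)" for j
    using power_mod_CARD_minus_1[OF primitive_element_nonzero[OF assms(1)], of "m + k"] assms(2)
    by (simp add: power_mult power_add power_mult_distrib)
  ultimately show "rotate m (trace_word q n \<alpha> s i \<beta>) ! k
      = trace_word q n \<alpha> s i (\<lambda>j. \<alpha> ^ (m * i j) * \<beta> j) ! k"
    using k by (simp add: nth_rotate nth_trace_word mult_ac)
qed simp

text \<open>Expanding the traces turns the word of \<open>\<beta>\<close> into the values, at all nonzero field elements, of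
  a polynomial of degree below \<open>N\<close> with coefficients \<open>\<beta> j ^ (q ^ r)\<close>; their positions
  do not collide by the assumptions on the cyclotomic cosets.\<close>

lemma trace_word_eq_0_imp:
  fixes \<alpha> :: "'a::finite_field" and s :: nat
  assumes q: "primepow q" and n: "n \<ge> 1" and card: "CARD('a) = q ^ n"
    and prim: "primitive_element \<alpha>"
    and inj: "inj_on (\<lambda>(j, r). (i j * q ^ r) mod (q ^ n - 1)) ({1..s} \<times> {..<n})"
    and zero: "\<And>k. k < q ^ n - 1 \<Longrightarrow> field_trace q n (\<Sum>j=1..s. \<beta> j * \<alpha> ^ (k * i j)) = 0"
    and j: "j \<in> {1..s}"
  shows "\<beta> j = 0"
proof -
  let ?N = "q ^ n - 1" and ?e = "\<lambda>(j, r). (i j * q ^ r) mod (q ^ n - 1)"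
  let ?S = "{1..s} \<times> {..<n}"
  note nz = primitive_element_nonzero[OF prim]
  have N0: "?N > 0" using finite_field_CARD_gt_1[where 'a='a] card by simp
  define P where "P = (\<Sum>x\<in>?S. monom (\<beta> (fst x) ^ (q ^ snd x)) (?e x))"
  have "poly P x = 0" if "x \<in> UNIV - {0}" for x
  proof -
    have "(\<lambda>k. \<alpha> ^ k) ` {..<?N} = UNIV - {0}"
      using bij_betw_imp_surj_on[OF bij_betw_primitive_powers[OF prim]] unfolding card .
    with that have "x \<in> (\<lambda>k. \<alpha> ^ k) ` {..<?N}" by simp
    then obtain k where k: "k < ?N" "x = \<alpha> ^ k" by blast
    have *: "\<beta> j ^ (q ^ r) * x ^ (i j * q ^ r mod ?N) = (\<beta> j * \<alpha> ^ (k * i j)) ^ (q ^ r)" for j r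
    proof -
      have "x ^ (i j * q ^ r mod ?N) = x ^ (i j * q ^ r)"
        using power_mod_CARD_minus_1[of x] that unfolding card by simp
      also have "\<dots> = (\<alpha> ^ (k * i j)) ^ (q ^ r)"
        unfolding k(2) by (simp only: mult.assoc flip: power_mult)
      finally show ?thesis by (simp add: power_mult_distrib)
    qed
    have "poly P x = (\<Sum>(j, r)\<in>?S. \<beta> j ^ (q ^ r) * x ^ (i j * q ^ r mod ?N))"
      by (simp add: P_def poly_sum poly_monom split_def)
    also have "\<dots> = (\<Sum>(j, r)\<in>?S. (\<beta> j * \<alpha> ^ (k * i j)) ^ (q ^ r))"
      by (simp only: *)
    also have "\<dots> = (\<Sum>j=1..s. field_trace q n (\<beta> j * \<alpha> ^ (k * i j)))"
      by (simp add: field_trace_def sum.cartesian_product)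
    also have "\<dots> = 0" using zero[OF k(1)] by (simp add: field_trace_sum[OF q card])
    finally show ?thesis .
  qed
  moreover have "degree P < ?N"
    unfolding P_def
  proof (rule degree_sum_less[OF _ N0])
    fix x assume "x \<in> ?S"
    have "degree (monom (\<beta> (fst x) ^ (q ^ snd x)) (?e x)) \<le> ?e x" by (rule degree_monom_le)
    also have "\<dots> < ?N" using N0 by (simp add: split_def)
    finally show "degree (monom (\<beta> (fst x) ^ (q ^ snd x)) (?e x)) < ?N" .
  qed
  \<comment> \<open>\<open>P\<close> has more zeros than its degree allows, so it is the zero
    polynomial.\<close>
  moreover have "card (UNIV - {0 :: 'a}) = ?N" by (simp add: card card_Diff_singleton)
  ultimately have P0: "P = 0"
    using N0 by (intro poly_eqI_degree[of "UNIV - {0}"]) auto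
  have mem: "(j, 0) \<in> ?S" using j n by auto
  \<comment> \<open>The monomial with \<open>r = 0\<close> carries
    \<open>\<beta> j ^ (q ^ 0) = \<beta> j\<close> itself, and by injectivity no other monomial has
    this exponent.\<close>
  have "coeff P (?e (j, 0)) = (\<Sum>x\<in>?S. if x = (j, 0) then \<beta> (fst x) ^ (q ^ snd x) else 0)"
    unfolding P_def coeff_sum coeff_monom
    by (intro sum.cong refl) (use inj_on_eq_iff[OF inj _ mem] in auto)
  also have "\<dots> = \<beta> j" using mem by (subst sum.delta) auto
  finally show ?thesis using P0 by simp
qed

lemma trace_word_inject:
  fixes \<alpha> :: "'a::finite_field"
  assumes q: "primepow q" and n: "n \<ge> 1" and card: "CARD('a) = q ^ n"
    and prim: "primitive_element \<alpha>"
    and inj: "inj_on (\<lambda>(j, r). (i j * q ^ r) mod (q ^ n - 1)) ({1..s} \<times> {..<n})"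
    and eq: "trace_word q n \<alpha> s i \<beta> = trace_word q n \<alpha> s i \<gamma>"
    and j: "j \<in> {1..s}"
  shows "\<beta> j = \<gamma> j"
proof -
  have "field_trace q n (\<Sum>j=1..s. (\<beta> j - \<gamma> j) * \<alpha> ^ (k * i j)) = 0" if k: "k < q ^ n - 1" for k
  proof -
    let ?T = "\<lambda>\<beta>. \<Sum>j=1..s. \<beta> j * \<alpha> ^ (k * i j)"
    have "?T \<beta> = ?T (\<lambda>j. \<beta> j - \<gamma> j) + ?T \<gamma>"
      by (simp add: sum.distrib[symmetric] algebra_simps)
    hence "field_trace q n (?T \<beta>) = field_trace q n (?T (\<lambda>j. \<beta> j - \<gamma> j)) + field_trace q n (?T \<gamma>)"
      by (simp only: field_trace_add[OF q card])
    moreover have "field_trace q n (?T \<beta>) = field_trace q n (?T \<gamma>)"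
      using arg_cong[OF eq, of "\<lambda>w. w ! k"] k by (simp add: nth_trace_word)
    ultimately show ?thesis by simp
  qed
  from trace_word_eq_0_imp[OF q n card prim inj this j] show ?thesis by simp
qed

section \<open>Largest scalar fields\<close>

text \<open>Every field over which \<open>V\<close> is a vector space consists of multipliers of
  \<open>V\<close>. Conversely the multipliers form a field, finiteness giving closure under
  inverses.\<close>

lemma largest_scalar_field_multipliers:
  fixes V :: "'a::finite_field set"
  assumes F: "is_subfield F" and V: "subspace_over F V"
  shows "largest_scalar_field F V {c. \<forall>x\<in>V. c * x \<in> V}"
proof -
  let ?M = "{c. \<forall>x\<in>V. c * x \<in> V}"
  have pow: "c ^ k \<in> ?M" if "c \<in> ?M" for c k
    by (induction k) (use that in \<open>auto simp: mult.assoc\<close>)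
  \<comment> \<open>A nonzero \<open>c\<close> has the power \<open>c ^ (CARD('a) - 2)\<close> as
    its inverse; for \<open>c = 0\<close> the convention \<open>inverse 0 = 0\<close>
    applies.\<close>
  have inv: "inverse c \<in> ?M" if c: "c \<in> ?M" for c
  proof (cases "c = 0")
    case False
    have "c * c ^ (CARD('a) - 2) = 1"
      using finite_field_power_card_minus_1[OF False] finite_field_CARD_gt_1[where 'a='a]
      by (simp add: Suc_diff_Suc numeral_2_eq_2 flip: power_Suc)
    hence "inverse c = c ^ (CARD('a) - 2)" using inverse_unique by blast
    thus ?thesis using pow[OF c] by simp
  qed (use c in simp)
  have neg: "- x \<in> V" if "x \<in> V" for x
  proof -
    have "- 1 \<in> F" using F by (simp add: is_subfield_def)
    hence "- 1 * x \<in> V" using V that unfolding subspace_over_def by blast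
    thus ?thesis by simp
  qed
  have "is_subfield ?M"
    unfolding is_subfield_def using V inv neg
    by (auto simp: subspace_over_def distrib_right mult.assoc)
  moreover have "F \<subseteq> ?M" and "subspace_over ?M V"
    and "\<And>K. subspace_over K V \<Longrightarrow> K \<subseteq> ?M"
    using V by (auto simp: subspace_over_def)
  ultimately show ?thesis by (simp add: largest_scalar_field_def intermediate_field_def)
qed

lemma largest_scalar_field_unique:
  "largest_scalar_field F V K \<Longrightarrow> largest_scalar_field F V K' \<Longrightarrow> K = K'"
  unfolding largest_scalar_field_def by blast

text \<open>A scalar \<open>c\<close> of \<open>K\<close> must lie in \<open>K\<close> because
  \<open>c = c * 1\<close>. So every intermediate field occurs as a largest scalar field, with
  itself as the witness.\<close>

lemma largest_scalar_field_self:
  assumes "intermediate_field F K"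
  shows "largest_scalar_field F K K"
proof -
  have "subspace_over K K" and one: "1 \<in> K"
    using assms by (auto simp: intermediate_field_def is_subfield_def subspace_over_def)
  moreover have "K' \<subseteq> K" if K': "subspace_over K' K" for K'
  proof
    fix c assume "c \<in> K'"
    with K' one have "c * 1 \<in> K" unfolding subspace_over_def by blast
    thus "c \<in> K" by simp
  qed
  ultimately show ?thesis using assms unfolding largest_scalar_field_def by blast
qed

text \<open>This is the space for coefficients that should not affect the index: its degree is
  \<open>n\<close>, so its contribution to the least common multiple is 1.\<close>

lemma largest_scalar_field_zero:
  "largest_scalar_field F {0} UNIV"
  by (simp add: largest_scalar_field_def intermediate_field_def is_subfield_def subspace_over_def)

section \<open>Linearity and invariant shifts of the codes\<close>

text \<open>Both sides say that \<open>lcm e (L_quot q n d)\<close> divides \<open>m * e\<close>, as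
  \<open>e\<close> divides it anyway.\<close>

lemma ell_dvd_iff:
  assumes "e \<ge> 1"
  shows "ell q n e d dvd m \<longleftrightarrow> L_quot q n d dvd m * e"
  using assms by (simp add: ell_def div_dvd_iff_mult)

lemma linear_code_trace_code:
  fixes \<alpha> :: "'a::finite_field"
  assumes q: "primepow q" and card: "CARD('a) = q ^ n"
    and prim: "primitive_element \<alpha>"
    and F: "is_subfield F" "card F = q"
    and V: "\<forall>j\<in>{1..s}. subspace_over F (V j)"
  shows "linear_code F (q ^ n - 1) (trace_code q n \<alpha> s i V)"
proof -
  have q1: "q \<ge> 1" using primepow_gt_Suc_0[OF q] by simp
  have "set (trace_word q n \<alpha> s i \<beta>) \<subseteq> F" for \<beta>
    using field_trace_in_subfield[OF q card prim F] by (auto simp: trace_word_def)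
  moreover have "replicate (q ^ n - 1) 0 = trace_word q n \<alpha> s i (\<lambda>_. 0)"
    by (rule nth_equalityI) (simp_all add: nth_trace_word field_trace_0[OF q1])
  moreover have "c ^ q = c" if "c \<in> F" for c
    using subfield_mem_iff_power_card[OF prim F(1)] F(2) that by simp
  ultimately show ?thesis
    using V unfolding linear_code_def trace_code_eq subspace_over_def
    by (auto simp: trace_word_add[OF q card] trace_word_mult intro!: imageI)
qed

lemma shift_invariant_trace_code_iff:
  fixes \<alpha> :: "'a::finite_field"
  assumes q: "primepow q" and n: "n \<ge> 1" and card: "CARD('a) = q ^ n"
    and prim: "primitive_element \<alpha>"
    and inj: "inj_on (\<lambda>(j, r). (i j * q ^ r) mod (q ^ n - 1)) ({1..s} \<times> {..<n})"
    and F: "is_subfield F"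
    and i: "\<forall>j\<in>{1..s}. i j \<ge> 1"
    and V: "\<forall>j\<in>{1..s}. subspace_over F (V j)"
    and d: "\<forall>j\<in>{1..s}. \<exists>K. largest_scalar_field F (V j) K \<and> card K = q ^ d j"
  shows "shift_invariant m (trace_code q n \<alpha> s i V)
    \<longleftrightarrow> Lcm ((\<lambda>j. ell q n (i j) (d j)) ` {1..s}) dvd m"
proof -
  have ell: "ell q n (i j) (d j) dvd m \<longleftrightarrow> (\<forall>x\<in>V j. \<alpha> ^ (m * i j) * x \<in> V j)"
    if j: "j \<in> {1..s}" for j
  proof -
    obtain K where K: "largest_scalar_field F (V j) K" "card K = q ^ d j" using d j by blast
    have "ell q n (i j) (d j) dvd m \<longleftrightarrow> (CARD('a) - 1) div (card K - 1) dvd m * i j"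
      using i j by (simp add: ell_dvd_iff L_quot_def card K(2))
    also have "\<dots> \<longleftrightarrow> \<alpha> ^ (m * i j) \<in> K"
      using subfield_primitive_powers(2)[OF prim] K(1)
      by (simp add: largest_scalar_field_def intermediate_field_def)
    also have "K = {c. \<forall>x\<in>V j. c * x \<in> V j}"
      using largest_scalar_field_unique[OF K(1) largest_scalar_field_multipliers[OF F]] V j by blast
    finally show ?thesis by simp
  qed
  have "shift_invariant m (trace_code q n \<alpha> s i V)
    \<longleftrightarrow> (\<forall>j\<in>{1..s}. \<forall>x\<in>V j. \<alpha> ^ (m * i j) * x \<in> V j)"
  proof
    assume inv: "shift_invariant m (trace_code q n \<alpha> s i V)"
    show "\<forall>j\<in>{1..s}. \<forall>x\<in>V j. \<alpha> ^ (m * i j) * x \<in> V j"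
    proof (intro ballI)
      fix j x assume j: "j \<in> {1..s}" and x: "x \<in> V j"
      \<comment> \<open>A word with only its \<open>j\<close>-th coefficient nonzero isolates the
        condition on \<open>V j\<close>; the other coefficients may be 0 since each
        \<open>V k\<close> contains 0.\<close>
      define \<beta> where "\<beta> = (\<lambda>k. if k = j then x else 0)"
      have "\<forall>k\<in>{1..s}. \<beta> k \<in> V k"
        using V x by (auto simp: \<beta>_def subspace_over_def)
      hence "rotate m (trace_word q n \<alpha> s i \<beta>) \<in> trace_code q n \<alpha> s i V"
        using inv by (auto simp: shift_invariant_def trace_code_eq)
      then obtain \<gamma> where \<gamma>: "\<forall>k\<in>{1..s}. \<gamma> k \<in> V k"
        "trace_word q n \<alpha> s i (\<lambda>k. \<alpha> ^ (m * i k) * \<beta> k) = trace_word q n \<alpha> s i \<gamma>"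
        by (auto simp: trace_code_eq rotate_trace_word[OF prim card])
      from trace_word_inject[OF q n card prim inj \<gamma>(2) j] \<gamma>(1) j
      show "\<alpha> ^ (m * i j) * x \<in> V j" by (simp add: \<beta>_def)
    qed
  next
    assume "\<forall>j\<in>{1..s}. \<forall>x\<in>V j. \<alpha> ^ (m * i j) * x \<in> V j"
    thus "shift_invariant m (trace_code q n \<alpha> s i V)"
      by (auto simp: shift_invariant_def trace_code_eq rotate_trace_word[OF prim card])
  qed
  thus ?thesis using ell by (auto simp: Lcm_dvd_iff)
qed

section \<open>The index of a coefficient subcode and the set of all such indices\<close>

theorem theorem2p6:
  fixes q n N s :: nat
    and F :: "'a::finite_field set"
    and \<alpha> :: 'a
    and i :: "nat \<Rightarrow> nat"
    and C :: "'a list set"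
  assumes "primepow q" and "n \<ge> 1" and "CARD('a) = q ^ n"
    and "is_subfield F" and "card F = q"
    and N: "N = q ^ n - 1"
    and "primitive_element \<alpha>"
    and "s \<ge> 1"
    and "\<forall>j\<in>{1..s}. i j \<ge> 1"
    and "\<forall>j\<in>{1..s}. \<forall>k\<in>{1..s}. j \<noteq> k \<longrightarrow> cyclotomic_coset q N (i j) \<noteq> cyclotomic_coset q N (i k)"
    and "\<forall>j\<in>{1..s}. card (cyclotomic_coset q N (i j)) = n"
    and C: "C = full_trace_code q n \<alpha> s i"
  shows
    "(\<forall>(V :: nat \<Rightarrow> 'a set) (d :: nat \<Rightarrow> nat) l.
        (\<forall>j\<in>{1..s}. subspace_over F (V j)) \<longrightarrow>
        (\<forall>j\<in>{1..s}. \<exists>K. largest_scalar_field F (V j) K \<and> card K = q ^ d j) \<longrightarrow>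
        l = Lcm ((\<lambda>j. ell q n (i j) (d j)) ` {1..s}) \<longrightarrow>
        l \<noteq> N \<longrightarrow>
        trace_code q n \<alpha> s i V \<subseteq> C \<and> quasi_cyclic F N l (trace_code q n \<alpha> s i V))
   \<and> (\<forall>(u :: nat) (E :: nat \<Rightarrow> 'a set) (d :: nat \<Rightarrow> nat).
        bij_betw E {1..u} {K. intermediate_field F K} \<longrightarrow>
        (\<forall>a\<in>{1..u}. card (E a) = q ^ d a) \<longrightarrow>
        d 1 = 1 \<longrightarrow> d u = n \<longrightarrow>
        (\<forall>l \<in> index_set q n s i u d.
           \<exists>D. coefficient_subcode F q n \<alpha> s i D \<and> D \<subseteq> C \<and> quasi_cyclic F N l D)
      \<and> (\<forall>D l. coefficient_subcode F q n \<alpha> s i D \<and> D \<subseteq> C \<and> quasi_cyclic F N l D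
           \<longrightarrow> l \<in> index_set q n s i u d))"
proof -
  note q = assms(1) and n = assms(2) and card = assms(3) and F = assms(4,5)
    and prim = assms(7) and s = assms(8) and i = assms(9)
  have q1: "q \<ge> 1" using primepow_gt_Suc_0[OF q] by simp
  have N0: "N > 0" using finite_field_CARD_gt_1[where 'a='a] card N by simp
  have inj: "inj_on (\<lambda>(j, r). (i j * q ^ r) mod (q ^ n - 1)) ({1..s} \<times> {..<n})"
    using cyclotomic_exponents_inj[OF q1 n N assms(10,11)] by (simp add: N)
  have sub: "trace_code q n \<alpha> s i V \<subseteq> C" for V
    unfolding C trace_code_eq by auto
  define good where "good V d \<longleftrightarrow> (\<forall>j\<in>{1..s}. subspace_over F (V j)) \<and>
      (\<forall>j\<in>{1..s}. \<exists>K. largest_scalar_field F (V j) K \<and> card K = q ^ d j)"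
    for V :: "nat \<Rightarrow> 'a set" and d :: "nat \<Rightarrow> nat"
  have shift: "shift_invariant m (trace_code q n \<alpha> s i V)
      \<longleftrightarrow> Lcm ((\<lambda>j. ell q n (i j) (d j)) ` {1..s}) dvd m" if "good V d" for V d m
    using shift_invariant_trace_code_iff[OF q n card prim inj F(1) i] that
    unfolding good_def by blast
  have qc: "quasi_cyclic F N l (trace_code q n \<alpha> s i V)
      \<longleftrightarrow> l = Lcm ((\<lambda>j. ell q n (i j) (d j)) ` {1..s}) \<and> l \<noteq> N" if g: "good V d" for V d l
  proof -
    let ?l = "Lcm ((\<lambda>j. ell q n (i j) (d j)) ` {1..s})"
    have lin: "linear_code F N (trace_code q n \<alpha> s i V)"
      using linear_code_trace_code[OF q card prim F] g unfolding good_def N by blast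
    \<comment> \<open>Rotation by the full length fixes every word, so \<open>?l\<close> divides
      \<open>N\<close> and cannot be 0.\<close>
    have "shift_invariant N (trace_code q n \<alpha> s i V)"
      unfolding shift_invariant_def trace_code_eq by (auto simp: N)
    hence "?l dvd N" using shift[OF g] by simp
    hence l0: "?l > 0" using N0 by (metis dvd_0_left gr0I less_irrefl)
    show ?thesis
    proof
      assume "quasi_cyclic F N l (trace_code q n \<alpha> s i V)"
      \<comment> \<open>The shift by \<open>?l\<close> itself preserves the code, so minimality of
        \<open>l\<close> excludes \<open>?l < l\<close>.\<close>
      hence l: "l \<noteq> N" "l > 0" "?l dvd l" "\<not> ?l < l"
        using l0 unfolding quasi_cyclic_def shift[OF g] by auto
      from l(3,2) have "?l \<le> l" by (rule dvd_imp_le)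
      with l show "l = ?l \<and> l \<noteq> N" by simp
    next
      assume "l = ?l \<and> l \<noteq> N"
      thus "quasi_cyclic F N l (trace_code q n \<alpha> s i V)"
        unfolding quasi_cyclic_def shift[OF g] using lin l0 by (auto dest: dvd_imp_le)
    qed
  qed
  show ?thesis
  proof (rule conjI; intro allI impI)
    fix V :: "nat \<Rightarrow> 'a set" and d :: "nat \<Rightarrow> nat" and l
    assume "\<forall>j\<in>{1..s}. subspace_over F (V j)"
      and "\<forall>j\<in>{1..s}. \<exists>K. largest_scalar_field F (V j) K \<and> card K = q ^ d j"
      and "l = Lcm ((\<lambda>j. ell q n (i j) (d j)) ` {1..s})" and "l \<noteq> N"
    thus "trace_code q n \<alpha> s i V \<subseteq> C \<and> quasi_cyclic F N l (trace_code q n \<alpha> s i V)"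
      using sub qc[of V d l] by (auto simp: good_def)
  next
    fix u and E :: "nat \<Rightarrow> 'a set" and d :: "nat \<Rightarrow> nat"
    assume E: "bij_betw E {1..u} {K. intermediate_field F K}"
      and d: "\<forall>a\<in>{1..u}. card (E a) = q ^ d a" and "d 1 = 1" "d u = n"
    have EI: "intermediate_field F (E a)" if "a \<in> {1..u}" for a
      using bij_betwE[OF E] that by auto
    show "(\<forall>l \<in> index_set q n s i u d.
           \<exists>D. coefficient_subcode F q n \<alpha> s i D \<and> D \<subseteq> C \<and> quasi_cyclic F N l D)
      \<and> (\<forall>D l. coefficient_subcode F q n \<alpha> s i D \<and> D \<subseteq> C \<and> quasi_cyclic F N l D
           \<longrightarrow> l \<in> index_set q n s i u d)"
    proof (intro conjI ballI allI impI)
      fix l assume l_in: "l \<in> index_set q n s i u d"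
      hence lN: "l \<noteq> N" by (simp add: index_set_def N)
      from l_in obtain m :: nat and a t where l: "l = Lcm ((\<lambda>r. ell q n (i (t r)) (d (a r))) ` {1..m})"
        and a: "a \<in> {1..m} \<rightarrow> {1..u}" and t: "t \<in> {1..m} \<rightarrow> {1..s}" "inj_on t {1..m}"
        unfolding index_set_def by blast
      \<comment> \<open>\<open>T\<close> is the set of selected coordinates and \<open>b\<close> is
        \<open>a\<close> transported along the inverse of \<open>t\<close>, so that each selected
        coordinate knows its field.\<close>
      define T where "T = t ` {1..m}"
      define b where "b j = a (the_inv_into {1..m} t j)" for j
      have b: "b (t r) = a r" if "r \<in> {1..m}" for r
        using the_inv_into_f_f[OF t(2) that] by (simp add: b_def)
      have bu: "b j \<in> {1..u}" if "j \<in> T" for j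
        using that a b unfolding T_def by (auto simp: Pi_iff)
      \<comment> \<open>A selected coordinate gets its intermediate field as subspace, the others
        get the zero space; \<open>e\<close> records the degrees of their largest scalar fields,
        which is \<open>n\<close> for the zero space.\<close>
      define V where "V j = (if j \<in> T then E (b j) else {0})" for j
      define e where "e j = (if j \<in> T then d (b j) else n)" for j
      have "\<exists>K. largest_scalar_field F (V j) K \<and> card K = q ^ e j" for j
      proof (cases "j \<in> T")
        case True
        thus ?thesis
          using largest_scalar_field_self[OF EI[OF bu[OF True]]] d bu[OF True]
          by (auto simp: V_def e_def)
      next
        case False
        thus ?thesis using largest_scalar_field_zero[of F] card
          by (auto simp: V_def e_def)
      qed
      moreover have V: "subspace_over F (V j)" for j
      proof (cases "j \<in> T")
        case True
        show ?thesis using EI[OF bu[OF True]] True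
          by (auto simp: V_def subspace_over_def intermediate_field_def is_subfield_def)
      qed (simp add: V_def subspace_over_def)
      ultimately have g: "good V e" by (simp add: good_def)
      have "Lcm ((\<lambda>j. ell q n (i j) (e j)) ` {1..s}) = l"
      proof (rule dvd_antisym)
        have "ell q n (i j) (e j) dvd l" if j: "j \<in> {1..s}" for j
        proof (cases "j \<in> T")
          case True
          then obtain r where "r \<in> {1..m}" "j = t r" by (auto simp: T_def)
          thus ?thesis using True by (auto simp: l e_def b intro!: dvd_Lcm)
        next
          case False
          \<comment> \<open>For degree \<open>n\<close> the quotient \<open>L_quot q n n\<close> is
            1, so the coordinates outside \<open>T\<close> leave the least common multiple
            unchanged.\<close>
          hence "ell q n (i j) (e j) = i j div i j"
            using N0 by (simp add: e_def ell_def L_quot_def N)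
          also have "\<dots> = 1" using i j by force
          finally have "ell q n (i j) (e j) = 1" .
          thus ?thesis by simp
        qed
        thus "Lcm ((\<lambda>j. ell q n (i j) (e j)) ` {1..s}) dvd l" by (simp add: Lcm_dvd_iff)
        have "ell q n (i (t r)) (d (a r)) dvd Lcm ((\<lambda>j. ell q n (i j) (e j)) ` {1..s})"
          if r: "r \<in> {1..m}" for r
        proof -
          have "t r \<in> T" "t r \<in> {1..s}" using r t(1) by (auto simp: T_def)
          hence "ell q n (i (t r)) (d (a r)) = ell q n (i (t r)) (e (t r))"
            using b[OF r] by (simp add: e_def)
          also have "\<dots> dvd Lcm ((\<lambda>j. ell q n (i j) (e j)) ` {1..s})"
            by (rule dvd_Lcm) (use \<open>t r \<in> {1..s}\<close> in blast)
          finally show ?thesis .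
        qed
        thus "l dvd Lcm ((\<lambda>j. ell q n (i j) (e j)) ` {1..s})"
          unfolding l by (intro Lcm_least) blast
      qed
      hence "quasi_cyclic F N l (trace_code q n \<alpha> s i V)" using qc[OF g] lN by simp
      moreover have "coefficient_subcode F q n \<alpha> s i (trace_code q n \<alpha> s i V)"
        unfolding coefficient_subcode_def using V by (intro exI[of _ V]) simp
      ultimately show "\<exists>D. coefficient_subcode F q n \<alpha> s i D \<and> D \<subseteq> C \<and> quasi_cyclic F N l D"
        using sub by (intro exI[of _ "trace_code q n \<alpha> s i V"]) simp
    next
      fix D l
      assume D: "coefficient_subcode F q n \<alpha> s i D \<and> D \<subseteq> C \<and> quasi_cyclic F N l D"
      then obtain V where V: "\<forall>j\<in>{1..s}. subspace_over F (V j)" and DV: "D = trace_code q n \<alpha> s i V"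
        unfolding coefficient_subcode_def by blast
      \<comment> \<open>The largest scalar field of \<open>V j\<close> is an intermediate field,
        hence one of the enumerated \<open>E a\<close>.\<close>
      have "\<exists>a\<in>{1..u}. largest_scalar_field F (V j) (E a)" if "j \<in> {1..s}" for j
      proof -
        have "subspace_over F (V j)" using V that by blast
        from largest_scalar_field_multipliers[OF F(1) this]
        obtain K where K: "largest_scalar_field F (V j) K" ..
        hence "K \<in> E ` {1..u}"
          using bij_betw_imp_surj_on[OF E] by (simp add: largest_scalar_field_def)
        with K show ?thesis by blast
      qed
      then obtain a where a: "\<And>j. j \<in> {1..s} \<Longrightarrow> a j \<in> {1..u}"
        "\<And>j. j \<in> {1..s} \<Longrightarrow> largest_scalar_field F (V j) (E (a j))" by metis
      have "good V (\<lambda>j. d (a j))" unfolding good_def using V a d by blast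
      \<comment> \<open>All coordinates are selected: \<open>m = s\<close> and \<open>t = id\<close>
        exhibit \<open>l\<close> as a member of the index set.\<close>
      from qc[OF this] D DV
      have l: "l = Lcm ((\<lambda>r. ell q n (i (id r)) (d (a r))) ` {1..s})" "l \<noteq> q ^ n - 1"
        by (simp_all add: N)
      moreover have "a \<in> {1..s} \<rightarrow> {1..u}" "id \<in> {1..s} \<rightarrow> {1..s}" "inj_on id {1..s}"
        using a by auto
      ultimately show "l \<in> index_set q n s i u d"
        unfolding index_set_def using s
        by (intro DiffI CollectI exI[of _ s] exI[of _ a] exI[of _ id] conjI) auto
    qed
  qed
qed

end
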